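(* Let $G$ be a finite $2$-group and let $n$ be a non-negative integer such that $|G'| > 2^{n(n-1)/2}$. Then there do not exist two proper subgroups $H_1, H_2$ of $G$, at least one of which has index at least $4$ in $G$, such that every element $x \in G$ with $b(x) \geq n$ lies in $H_1 \cup H_2$.
   Context: $G'$ denotes the derived subgroup of $G$. For $x$ in a finite $2$-group $G$, the breadth $b(x)$ is defined by $|G : C_G(x)| = 2^{b(x)}$, where $C_G(x)$ is the centralizer of $x$ in $G$. *)

theory Defs
  imports "HOL-Algebra.Algebra"
begin

definition centralizer :: "('a, 'b) monoid_scheme \<Rightarrow> 'a \<Rightarrow> 'a set" where
  "centralizer G x = {g \<in> carrier G. g \<otimes>\<^bsub>G\<^esub> x = x \<otimes>\<^bsub>G\<^esub> g}"

definition subgroup_index :: "('a, 'b) monoid_scheme \<Rightarrow> 'a set \<Rightarrow> nat" where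
  "subgroup_index G H = card (carrier G) div card H"

definition breadth :: "('a, 'b) monoid_scheme \<Rightarrow> 'a \<Rightarrow> nat" where
  "breadth G x = (THE b. subgroup_index G (centralizer G x) = 2 ^ b)"

end

theory Submission
  imports Defs
begin

text \<open>
  If \<open>S\<close> has a subgroup \<open>D\<close> of index two and \<open>w \<in> S - D\<close>, then \<open>S/D'\<close> has the abelian subgroup
  \<open>D/D'\<close> of index two, so \<open>S'/D'\<close> consists of the cosets of the commutators \<open>[d, w]\<close> with \<open>d \<in> D\<close>,
  and \<open>|S' : D'| = |D : E|\<close> for \<open>E = {d \<in> D. [d, w] \<in> D'}\<close>. Let all elements of \<open>S\<close> outside
  \<open>H\<^sub>1 \<union> H\<^sub>2\<close> have breadth at most \<open>m\<close>. Some such \<open>D\<close> meets \<open>H\<^sub>1 \<union> H\<^sub>2\<close> inside one proper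
  subgroup \<open>K\<close>, while a suitable \<open>w\<close> is outside \<open>D \<union> H\<^sub>1 \<union> H\<^sub>2\<close>. An element \<open>y \<in> D\<close> outside \<open>K\<close>
  whose breadth in \<open>D\<close> is still \<open>m\<close> has the same commutators with \<open>D\<close> as with \<open>S\<close>, so
  \<open>[w, y] \<in> D'\<close> and \<open>y \<in> E\<close>. Hence \<open>|S'| \<le> 2\<^sup>m |D'|\<close> and induction on \<open>|S|\<close>, applied to \<open>D\<close> with the
  subgroups \<open>K\<close> and \<open>E\<close> and the bound \<open>m - 1\<close>, gives \<open>|S'| \<le> 2\<^bsup>m(m+1)/2\<^esup>\<close>; this needs
  \<open>E \<subseteq> K\<close> or \<open>|D : E| \<ge> 4\<close>. If \<open>E = D\<close>, then \<open>S' = D'\<close> and induction applies to \<open>D\<close> directly.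
  If \<open>|D : E| = 2\<close> and \<open>E \<noteq> K\<close>, then \<open>|S'| = 2|D'|\<close>, and the third subgroup \<open>Y\<close> of index two in
  \<open>D\<close> containing \<open>E \<inter> K\<close> shows that \<open>D\<close> does not attain the bound \<open>2\<^bsup>m(m+1)/2\<^esup>\<close>.
\<close>

section \<open>Commutators, centralizers and class sizes relative to a subgroup\<close>

context group
begin

definition comm :: "'a \<Rightarrow> 'a \<Rightarrow> 'a" where
  "comm x y = x \<otimes> y \<otimes> inv x \<otimes> inv y"

definition cent :: "'a set \<Rightarrow> 'a \<Rightarrow> 'a set" where
  "cent S x = {s \<in> S. s \<otimes> x = x \<otimes> s}"

text \<open>The conjugates of \<open>x\<close> under \<open>S\<close>, each multiplied by \<open>x\<^sup>-\<^sup>1\<close>; for \<open>S = G\<close> the value is \<open>2\<^bsup>b(x)\<^esup>\<close>.\<close>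
definition class_size :: "'a set \<Rightarrow> 'a \<Rightarrow> nat" where
  "class_size S x = card ((\<lambda>s. comm s x) ` S)"

text \<open>\<open>D\<close> has index two in \<open>S\<close>, encoded as: membership in \<open>D\<close> is a nontrivial sign character of \<open>S\<close>.\<close>
definition index_two :: "'a set \<Rightarrow> 'a set \<Rightarrow> bool" where
  "index_two D S \<longleftrightarrow> subgroup S G \<and> D \<subset> S
     \<and> (\<forall>x\<in>S. \<forall>y\<in>S. x \<otimes> y \<in> D \<longleftrightarrow> (x \<in> D \<longleftrightarrow> y \<in> D))"

lemma mult_inv_cancel: "x \<in> carrier G \<Longrightarrow> y \<in> carrier G \<Longrightarrow> x \<otimes> (inv x \<otimes> y) = y"
  "x \<in> carrier G \<Longrightarrow> y \<in> carrier G \<Longrightarrow> inv x \<otimes> (x \<otimes> y) = y"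
  by (simp_all flip: m_assoc)

text \<open>Together with the standard simplification rules these normalize group words:
  right-nested, inverses on single letters, adjacent inverse pairs cancelled.\<close>

lemmas group_word = m_assoc inv_mult_group mult_inv_cancel

lemma comm_closed [simp]: "x \<in> carrier G \<Longrightarrow> y \<in> carrier G \<Longrightarrow> comm x y \<in> carrier G"
  by (simp add: comm_def)

lemma inv_comm_eq: "x \<in> carrier G \<Longrightarrow> y \<in> carrier G \<Longrightarrow> inv (comm x y) = comm y x"
  by (simp add: comm_def group_word)

lemma comm_eq_one_iff:
  assumes "x \<in> carrier G" "y \<in> carrier G"
  shows "comm x y = \<one> \<longleftrightarrow> x \<otimes> y = y \<otimes> x"
proof -
  have "comm x y \<otimes> (y \<otimes> x) = x \<otimes> y"
    using assms by (simp add: comm_def group_word)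
  then show ?thesis
    using assms by (metis comm_closed l_one m_closed r_cancel_one)
qed

lemma comm_mult_left:
  "x \<in> carrier G \<Longrightarrow> y \<in> carrier G \<Longrightarrow> w \<in> carrier G \<Longrightarrow>
    comm (x \<otimes> y) w = x \<otimes> comm y w \<otimes> inv x \<otimes> comm x w"
  by (simp add: comm_def group_word)

lemma comm_mult_right:
  "x \<in> carrier G \<Longrightarrow> y \<in> carrier G \<Longrightarrow> w \<in> carrier G \<Longrightarrow>
    comm w (x \<otimes> y) = comm w x \<otimes> (x \<otimes> comm w y \<otimes> inv x)"
  by (simp add: comm_def group_word)

text \<open>Multiplying by \<open>inv x\<close> on the left and by \<open>w \<otimes> y\<close> on
  the right clears the inverses. The right-hand side has the form that \<open>card_fibres\<close>
  expects, with \<open>K\<close> a centralizer.\<close>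

lemma comm_left_eq_iff:
  assumes "x \<in> carrier G" "y \<in> carrier G" "w \<in> carrier G"
  shows "comm x w = comm y w \<longleftrightarrow> (inv x \<otimes> y) \<otimes> w = w \<otimes> (inv x \<otimes> y)"
proof -
  have "comm x w = comm y w \<longleftrightarrow> inv x \<otimes> comm x w \<otimes> (w \<otimes> y) = inv x \<otimes> comm y w \<otimes> (w \<otimes> y)"
    using assms by simp
  also have "inv x \<otimes> comm x w \<otimes> (w \<otimes> y) = w \<otimes> (inv x \<otimes> y)"
    using assms by (simp add: comm_def group_word)
  also have "inv x \<otimes> comm y w \<otimes> (w \<otimes> y) = (inv x \<otimes> y) \<otimes> w"
    using assms by (simp add: comm_def group_word)
  finally show ?thesis by auto
qed

text \<open>The fibre of \<open>f\<close> through \<open>s\<close> is the translate of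
  \<open>K\<close> by \<open>s\<close>, so all fibres have size \<open>card K\<close>. This one
  count serves for centralizers, index-two subgroups, cosets, orbits and quotient maps.\<close>

lemma card_fibres:
  assumes S: "subgroup S G" "finite S" and K: "K \<subseteq> S"
    and f: "\<And>s t. s \<in> S \<Longrightarrow> t \<in> S \<Longrightarrow> f s = f t \<longleftrightarrow> inv s \<otimes> t \<in> K"
  shows "card S = card (f ` S) * card K"
proof -
  interpret S: subgroup S G by fact
  have "card {t \<in> S. f t = y} = card K" if "y \<in> f ` S" for y
  proof -
    from that obtain s where s: "s \<in> S" "y = f s" by auto
    have "{t \<in> S. f t = y} = (\<lambda>k. s \<otimes> k) ` K"
    proof (intro equalityI subsetI)
      fix t assume "t \<in> {t \<in> S. f t = y}"
      then have t: "t \<in> S" "f s = f t" using s by auto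
      then have "inv s \<otimes> t \<in> K" using f s by blast
      moreover have "t = s \<otimes> (inv s \<otimes> t)" using s t by (simp add: group_word)
      ultimately show "t \<in> (\<lambda>k. s \<otimes> k) ` K" by blast
    next
      fix t assume "t \<in> (\<lambda>k. s \<otimes> k) ` K"
      then obtain k where k: "k \<in> K" "t = s \<otimes> k" by blast
      have "k \<in> S" using k K by blast
      then have "t \<in> S" "inv s \<otimes> t = k" using s k by (simp_all add: group_word)
      then show "t \<in> {t \<in> S. f t = y}" using f[of s t] s k by auto
    qed
    moreover have "inj_on (\<lambda>k. s \<otimes> k) K"
      using s K by (intro inj_onI) (metis S.mem_carrier l_cancel subsetD)
    ultimately show ?thesis by (simp add: card_image)
  qed
  then have "(\<Sum>y\<in>f ` S. card {t \<in> S. f t = y}) = card (f ` S) * card K" by simp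
  moreover have "card S = (\<Sum>y\<in>f ` S. card {t \<in> S. f t = y})"
    using sum.image_gen[OF S(2), of "\<lambda>_. 1::nat" f] by simp
  ultimately show ?thesis by simp
qed

lemma cent_subgroup:
  assumes "subgroup S G" "x \<in> carrier G"
  shows "subgroup (cent S x) G"
proof -
  interpret S: subgroup S G by fact
  show ?thesis
  proof (rule subgroupI)
    show "cent S x \<subseteq> carrier G" by (auto simp: cent_def)
    show "cent S x \<noteq> {}" using assms by (auto simp: cent_def intro!: exI[of _ \<one>])
  next
    fix a assume a: "a \<in> cent S x"
    then have *: "a \<in> S" "a \<otimes> x = x \<otimes> a" by (auto simp: cent_def)
    then have "inv a \<otimes> (x \<otimes> a) \<otimes> inv a = inv a \<otimes> (a \<otimes> x) \<otimes> inv a" by simp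
    then have "inv a \<otimes> x = x \<otimes> inv a" using S.mem_carrier[OF *(1)] assms by (simp add: group_word)
    then show "inv a \<in> cent S x" using * by (simp add: cent_def)
  next
    fix a b assume "a \<in> cent S x" "b \<in> cent S x"
    then have *: "a \<in> S" "b \<in> S" "a \<otimes> x = x \<otimes> a" "b \<otimes> x = x \<otimes> b" by (auto simp: cent_def)
    then have "(a \<otimes> b) \<otimes> x = a \<otimes> (x \<otimes> b)" using assms by (simp add: m_assoc)
    also have "\<dots> = x \<otimes> (a \<otimes> b)" using * assms by (simp flip: m_assoc)
    finally show "a \<otimes> b \<in> cent S x" using * by (simp add: cent_def)
  qed
qed

text \<open>Orbit counting: two elements of \<open>S\<close> give the same commutator with
  \<open>x\<close> exactly when they differ by an element of \<open>cent S x\<close>. The element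
  \<open>x\<close> may lie outside \<open>S\<close>, as \<open>w\<close> lies outside
  \<open>D\<close> later.\<close>

lemma card_eq_class_size_cent:
  assumes "subgroup S G" "finite S" "x \<in> carrier G"
  shows "card S = class_size S x * card (cent S x)"
proof -
  interpret S: subgroup S G by fact
  show ?thesis unfolding class_size_def
    by (rule card_fibres[OF assms(1,2)]) (auto simp: cent_def comm_left_eq_iff assms(3))
qed

lemma class_size_mono: "finite S \<Longrightarrow> D \<subseteq> S \<Longrightarrow> class_size D x \<le> class_size S x"
  unfolding class_size_def by (intro card_mono) auto

lemma comm_in_derived: "x \<in> S \<Longrightarrow> y \<in> S \<Longrightarrow> comm x y \<in> derived G S"
  unfolding derived_def comm_def by (intro generate.incl) blast

lemma derived_subset: "subgroup S G \<Longrightarrow> derived G S \<subseteq> S"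
  using derived_incl by blast

section \<open>Subgroups of index two as kernels of sign characters\<close>

lemma index_twoD:
  assumes "index_two D S"
  shows "subgroup S G" "subgroup D G" "D \<subseteq> S" "D \<noteq> S"
    and "\<And>x y. x \<in> S \<Longrightarrow> y \<in> S \<Longrightarrow> x \<otimes> y \<in> D \<longleftrightarrow> (x \<in> D \<longleftrightarrow> y \<in> D)"
    and "\<And>x. x \<in> S \<Longrightarrow> inv x \<in> D \<longleftrightarrow> x \<in> D"
proof -
  show S: "subgroup S G" and DS: "D \<subseteq> S" "D \<noteq> S"
    and xy: "\<And>x y. x \<in> S \<Longrightarrow> y \<in> S \<Longrightarrow> x \<otimes> y \<in> D \<longleftrightarrow> (x \<in> D \<longleftrightarrow> y \<in> D)"
    using assms by (auto simp: index_two_def)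
  interpret S: subgroup S G by fact
  have one: "\<one> \<in> D" using xy[of \<one> \<one>] by simp
  show inv: "inv x \<in> D \<longleftrightarrow> x \<in> D" if "x \<in> S" for x
    using xy[of x "inv x"] that one by simp
  show "subgroup D G"
  proof (rule subgroupI)
    show "a \<otimes> b \<in> D" if "a \<in> D" "b \<in> D" for a b
      using xy[of a b] that DS by blast
  qed (use DS one inv in auto)
qed

lemma card_index_two:
  assumes "index_two D S" "finite S"
  shows "card S = 2 * card D"
proof -
  note h = index_twoD[OF assms(1)]
  interpret S: subgroup S G by (rule h)
  interpret D: subgroup D G by (rule h)
  obtain s where s: "s \<in> S" "s \<notin> D" using h(3,4) by blast
  have "(\<lambda>s. s \<in> D) ` S = {True, False}"
  proof -
    have "True \<in> (\<lambda>s. s \<in> D) ` S" 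
      using D.one_closed S.one_closed by (intro image_eqI[of _ _ \<one>]) simp_all
    moreover have "False \<in> (\<lambda>s. s \<in> D) ` S" 
      using s by (intro image_eqI[of _ _ s]) simp_all
    ultimately show ?thesis by auto
  qed
  moreover have "card S = card ((\<lambda>s. s \<in> D) ` S) * card D"
    by (rule card_fibres[OF h(1) assms(2) h(3)]) (use h in auto)
  ultimately show ?thesis by simp
qed

text \<open>The sign character of \<open>E\<close> restricts to \<open>D\<close>; the point is that
  the restriction is nontrivial. If \<open>D\<close> were inside \<open>E\<close>, an element of
  \<open>E - D\<close> times one outside \<open>E\<close> would lie in \<open>D\<close> but not in
  \<open>E\<close>.\<close>

lemma index_two_Int:
  assumes "index_two D S" "index_two E S" "D \<noteq> E"
  shows "index_two (D \<inter> E) D"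
proof -
  note d = index_twoD[OF assms(1)] and e = index_twoD[OF assms(2)]
  interpret S: subgroup S G by (rule d)
  have "D \<inter> E \<noteq> D"
  proof
    assume "D \<inter> E = D"
    then have sub: "D \<subseteq> E" by blast
    then obtain x where x: "x \<in> E" "x \<notin> D" using assms(3) by blast
    obtain y where y: "y \<in> S" "y \<notin> E" using e(3,4) by blast
    have "x \<otimes> y \<in> D" using d(5)[of x y] x y sub e by auto
    moreover have "x \<otimes> y \<notin> E" using e(5)[of x y] x y e by auto
    ultimately show False using sub by blast
  qed
  moreover have "x \<otimes> y \<in> D \<inter> E \<longleftrightarrow> (x \<in> D \<inter> E \<longleftrightarrow> y \<in> D \<inter> E)" if "x \<in> D" "y \<in> D" for x y
    using d(3) d(5)[of x y] e(5)[of x y] that by blast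
  ultimately show ?thesis
    unfolding index_two_def using d(2) by blast
qed

text \<open>The product of the sign characters of \<open>D\<close> and \<open>E\<close> is a third
  one; \<open>?T\<close> is where the two agree.\<close>

lemma index_two_third:
  assumes "index_two D S" "index_two E S" "D \<noteq> E"
  shows "index_two (D \<inter> E \<union> (S - (D \<union> E))) S" (is "index_two ?T S")
proof -
  note d = index_twoD[OF assms(1)] and e = index_twoD[OF assms(2)]
  interpret S: subgroup S G by (rule d)
  obtain x where x: "x \<in> D" "x \<notin> E"
    using index_twoD(4)[OF index_two_Int[OF assms]] by blast
  then have "?T \<noteq> S" using d(3) by blast
  moreover have "x \<otimes> y \<in> ?T \<longleftrightarrow> (x \<in> ?T \<longleftrightarrow> y \<in> ?T)" if "x \<in> S" "y \<in> S" for x y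
    using d(3) d(5)[of x y] e(5)[of x y] S.m_closed[OF that] that by blast
  ultimately show ?thesis
    unfolding index_two_def using d(1,3) by blast
qed

text \<open>As the kernel of a sign character \<open>D\<close> is normal in \<open>S\<close>, and
  the derived subgroup of a normal subgroup is normal.\<close>

lemma index_two_conj_derived:
  assumes "index_two D S" "s \<in> S" "k \<in> derived G D"
  shows "s \<otimes> k \<otimes> inv s \<in> derived G D"
proof -
  note d = index_twoD[OF assms(1)]
  interpret S: subgroup S G by (rule d)
  interpret D: subgroup D G by (rule d)
  let ?S = "G\<lparr>carrier := S\<rparr>"
  interpret GS: group ?S by (rule subgroup_imp_group[OF d(1)])
  have "D \<lhd> ?S"
  proof (rule GS.normalI[OF subgroup_incl[OF d(2,1,3)]])
    show "\<forall>x\<in>carrier ?S. D #>\<^bsub>?S\<^esub> x = x <#\<^bsub>?S\<^esub> D"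
    proof
      fix x assume x: "x \<in> carrier ?S"
      show "D #>\<^bsub>?S\<^esub> x = x <#\<^bsub>?S\<^esub> D"
      proof (intro equalityI subsetI)
        fix y assume "y \<in> D #>\<^bsub>?S\<^esub> x"
        then obtain k where k: "k \<in> D" "y = k \<otimes> x" by (auto simp: r_coset_def)
        then have "inv x \<otimes> k \<otimes> x \<in> D" "y = x \<otimes> (inv x \<otimes> k \<otimes> x)"
          using x d(3,5,6) by (auto simp: subset_iff group_word)
        then show "y \<in> x <#\<^bsub>?S\<^esub> D" by (auto simp: l_coset_def)
      next
        fix y assume "y \<in> x <#\<^bsub>?S\<^esub> D"
        then obtain k where k: "k \<in> D" "y = x \<otimes> k" by (auto simp: l_coset_def)
        then have "x \<otimes> k \<otimes> inv x \<in> D" "y = (x \<otimes> k \<otimes> inv x) \<otimes> x"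
          using x d(3,5,6) by (auto simp: subset_iff group_word)
        then show "y \<in> D #>\<^bsub>?S\<^esub> x" by (auto simp: r_coset_def)
      qed
    qed
  qed
  then have "derived ?S D \<lhd> ?S" by (rule GS.derived_is_normal)
  then have "s \<otimes>\<^bsub>?S\<^esub> k \<otimes>\<^bsub>?S\<^esub> inv\<^bsub>?S\<^esub> s \<in> derived G D"
    using assms normal.inv_op_closed2[of _ ?S s k] derived_consistent[OF d(3,1)] by simp
  then show ?thesis using assms d by simp
qed

section \<open>Comparing the derived subgroups of \<open>S\<close> and of an index-two subgroup
  \<open>D\<close>\<close>

text \<open>On the abelian group \<open>A\<close>, normalized by \<open>w\<close>, the map
  \<open>\<lambda>a. comm a w\<close> is a homomorphism into \<open>A\<close>, so its image is a
  subgroup. All commutators reduce to values of this map.\<close>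

lemma derived_abelian_index_two:
  assumes A: "subgroup A G" and ab: "\<And>a b. a \<in> A \<Longrightarrow> b \<in> A \<Longrightarrow> a \<otimes> b = b \<otimes> a"
    and w: "w \<in> carrier G" and norm: "\<And>a. a \<in> A \<Longrightarrow> w \<otimes> a \<otimes> inv w \<in> A"
    and cov: "\<And>x. x \<in> carrier G \<Longrightarrow> x \<in> A \<or> (\<exists>a\<in>A. x = a \<otimes> w)"
  shows "derived G (carrier G) = (\<lambda>a. comm a w) ` A" (is "_ = ?T")
proof
  interpret A: subgroup A G by (rule A)
  show "?T \<subseteq> derived G (carrier G)" using comm_in_derived w A.mem_carrier by blast
  have cA: "comm a w \<in> A" if "a \<in> A" for a
  proof -
    have "comm a w = a \<otimes> (w \<otimes> inv a \<otimes> inv w)" using that w by (simp add: comm_def m_assoc)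
    then show ?thesis using that norm by simp
  qed
  have conj: "a \<otimes> b \<otimes> inv a = b" if "a \<in> A" "b \<in> A" for a b
    using ab[OF that] that by (simp add: m_assoc)
  have mult: "comm a w \<otimes> comm b w = comm (b \<otimes> a) w" if "a \<in> A" "b \<in> A" for a b
    using that w cA by (simp add: comm_mult_left conj)
  have one: "comm \<one> w = \<one>" using w by (simp add: comm_def)
  have inv: "inv (comm a w) = comm (inv a) w" if "a \<in> A" for a
    using mult[of "inv a" a] that w one by (intro inv_equality) simp_all
  have T: "subgroup ?T G"
  proof (rule subgroupI)
    show "?T \<subseteq> carrier G" using w by auto
    show "?T \<noteq> {}" using A.one_closed by blast
    show "inv x \<in> ?T" if "x \<in> ?T" for x using that inv by auto
    show "x \<otimes> y \<in> ?T" if "x \<in> ?T" "y \<in> ?T" for x y using that mult by auto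
  qed
  interpret T: subgroup ?T G by (rule T)
  have ww: "comm w w = \<one>" "comm a b = \<one>" if "a \<in> A" "b \<in> A" for a b
    using comm_eq_one_iff w ab that by simp_all
  \<comment> \<open>Together with \<open>ww\<close>, the facts \<open>1\<close>, \<open>2\<close>
    and \<open>3\<close> treat all pairs: one element in \<open>A\<close> and one in the coset of
    \<open>w\<close>, in either order, or both in the coset.\<close>
  have 1: "comm (a \<otimes> w) b = inv (comm b w)" if "a \<in> A" "b \<in> A" for a b
  proof -
    have "comm w b \<in> A" using A.m_inv_closed[OF cA[OF that(2)]] inv_comm_eq[of b w] w that by simp
    then show ?thesis
      using that w by (simp add: comm_mult_left conj ww inv_comm_eq)
  qed
  have 2: "comm b (a \<otimes> w) = comm b w" if "a \<in> A" "b \<in> A" for a b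
    using 1[OF that] that w by (metis A.mem_carrier inv_comm_eq m_closed)
  have 3: "comm (a \<otimes> w) (b \<otimes> w) = inv (comm b w) \<otimes> comm a w" if "a \<in> A" "b \<in> A" for a b
  proof -
    have "comm (a \<otimes> w) w = comm a w" using that w by (simp add: comm_mult_left ww(1)[OF that])
    then show ?thesis using that w by (simp add: comm_mult_right 1 conj cA)
  qed
  have "comm x y \<in> ?T" if "x \<in> carrier G" "y \<in> carrier G" for x y
    using cov[OF that(1)] cov[OF that(2)] 1 2 3 ww(2) T.one_closed by auto
  then have "derived_set G (carrier G) \<subseteq> ?T" by (auto simp: comm_def)
  then show "derived G (carrier G) \<subseteq> ?T"
    unfolding derived_def using generate_subgroup_incl[OF _ T] by blast
qed

text \<open>This is the subgroup \<open>E\<close> of the outline, the kernel of taking commutators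
  with \<open>w\<close> modulo \<open>derived G D\<close>. Closure uses that conjugation by
  \<open>S\<close> preserves \<open>derived G D\<close>.\<close>

lemma commuting_mod_derived_subgroup:
  assumes "index_two D S" "w \<in> S"
  shows "subgroup {d \<in> D. comm d w \<in> derived G D} G" (is "subgroup ?X G")
proof -
  note d = index_twoD[OF assms(1)]
  interpret S: subgroup S G by (rule d)
  interpret D: subgroup D G by (rule d)
  interpret K: subgroup "derived G D" G using derived_is_subgroup D.subset by blast
  note normal = index_two_conj_derived[OF assms(1)]
  show ?thesis
  proof (rule subgroupI)
    show "?X \<subseteq> carrier G" by auto
    have "\<one> \<in> ?X" using assms by (simp add: comm_def)
    then show "?X \<noteq> {}" by blast
  next
    fix x assume x: "x \<in> ?X"
    have "comm (inv x) w = inv x \<otimes> inv (comm x w) \<otimes> inv (inv x)"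
      using x assms(2) by (simp add: comm_def group_word)
    then show "inv x \<in> ?X" using x d(3) normal[of "inv x" "inv (comm x w)"] by auto
  next
    fix x y assume x: "x \<in> ?X" and y: "y \<in> ?X"
    then show "x \<otimes> y \<in> ?X"
      using assms(2) d(3) normal[of x "comm y w"] by (auto simp: comm_mult_left)
  qed
qed

text \<open>The index equation |S' : D'| = |D : E| without division. It is read off in
  \<open>?Q\<close>, the quotient of \<open>S\<close> by \<open>derived G D\<close>, where the image
  of \<open>D\<close> is abelian.\<close>

lemma card_derived_index_two:
  assumes "index_two D S" "finite S" "w \<in> S" "w \<notin> D"
  shows "card (derived G S) * card {d \<in> D. comm d w \<in> derived G D} = card D * card (derived G D)"
proof -
  note d = index_twoD[OF assms(1)]
  interpret S: subgroup S G by (rule d)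
  interpret D: subgroup D G by (rule d)
  let ?S = "G\<lparr>carrier := S\<rparr>"
  let ?K = "derived G D"
  interpret GS: group ?S by (rule subgroup_imp_group[OF d(1)])
  interpret K: subgroup ?K G using derived_is_subgroup D.subset by blast
  have KD: "?K \<subseteq> D" using derived_subset[OF d(2)] .
  have invS: "inv\<^bsub>?S\<^esub> x = inv x" if "x \<in> S" for x using d(1) that by simp
  interpret N: normal ?K ?S
    using GS.normal_inv_iff subgroup_incl[OF K.subgroup_axioms d(1)] KD d(3)
      index_two_conj_derived[OF assms(1)] invS by auto
  let ?Q = "?S Mod ?K"
  let ?P = "\<lambda>g. ?K #>\<^bsub>?S\<^esub> g"
  interpret Q: group ?Q by (rule N.factorgroup_is_group)
  interpret P: group_hom ?S ?Q ?P
    using N.r_coset_hom_Mod Q.group_axioms GS.group_axioms by (simp add: group_hom_def group_hom_axioms_def)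
  have P_closed: "?P x \<in> carrier ?Q" if "x \<in> S" for x using P.hom_closed that by simp
  have P_mult: "?P (x \<otimes> y) = ?P x \<otimes>\<^bsub>?Q\<^esub> ?P y" if "x \<in> S" "y \<in> S" for x y
    using P.hom_mult that by simp
  have P_inv: "?P (inv x) = inv\<^bsub>?Q\<^esub> ?P x" if "x \<in> S" for x
    using P.hom_inv[of x] that invS by simp
  have P_comm: "?P (comm x y) = Q.comm (?P x) (?P y)" if "x \<in> S" "y \<in> S" for x y
    using that by (simp only: comm_def Q.comm_def P_mult P_inv S.m_closed S.m_inv_closed)
  have P_one: "?P x = \<one>\<^bsub>?Q\<^esub> \<longleftrightarrow> x \<in> ?K" if "x \<in> S" for x
    using that GS.coset_join1[of ?K x] GS.coset_join2[of x ?K] N.subset N.subgroup_axioms by auto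
  have P_eq: "?P s = ?P t \<longleftrightarrow> inv s \<otimes> t \<in> ?K" if "s \<in> S" "t \<in> S" for s t
  proof -
    have "?P s = ?P t \<longleftrightarrow> inv\<^bsub>?Q\<^esub> ?P s \<otimes>\<^bsub>?Q\<^esub> ?P t = \<one>\<^bsub>?Q\<^esub>"
      using P_closed that by (metis Q.inv_closed Q.inv_equality Q.inv_inv Q.l_inv)
    then show ?thesis using that P_one[of "inv s \<otimes> t"] P_mult P_inv by simp
  qed
  have coverS: "x \<in> D \<or> (\<exists>a\<in>D. x = a \<otimes> w)" if "x \<in> S" for x
  proof (cases "x \<in> D")
    case False
    then have "x \<otimes> inv w \<in> D" "x = x \<otimes> inv w \<otimes> w" using d(5,6) that assms by (simp_all add: m_assoc)
    then show ?thesis by blast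
  qed simp
  have "derived ?Q (carrier ?Q) = (\<lambda>a. Q.comm a (?P w)) ` ?P ` D"
  proof (rule Q.derived_abelian_index_two)
    show "subgroup (?P ` D) ?Q"
      using P.subgroup_img_is_subgroup subgroup_incl[OF d(2,1,3)] by simp
    show "a \<otimes>\<^bsub>?Q\<^esub> b = b \<otimes>\<^bsub>?Q\<^esub> a" if ab: "a \<in> ?P ` D" "b \<in> ?P ` D" for a b
    proof -
      from ab obtain x y where xy: "x \<in> D" "y \<in> D" "a = ?P x" "b = ?P y" by blast
      then have "Q.comm a b = \<one>\<^bsub>?Q\<^esub>"
        using P_comm[of x y] P_one[of "comm x y"] comm_in_derived[of x D y] d(3) KD by (auto simp: subset_iff)
      then show ?thesis using Q.comm_eq_one_iff xy d(3) P_closed by blast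
    qed
    show "?P w \<in> carrier ?Q" using P_closed assms by blast
    show "?P w \<otimes>\<^bsub>?Q\<^esub> a \<otimes>\<^bsub>?Q\<^esub> inv\<^bsub>?Q\<^esub> ?P w \<in> ?P ` D" if "a \<in> ?P ` D" for a
    proof -
      from that obtain x where x: "x \<in> D" "a = ?P x" by blast
      then have xS: "x \<in> S" using d(3) by blast
      then have "w \<otimes> x \<otimes> inv w \<in> D" using x d(5,6) assms by simp
      moreover have "?P w \<otimes>\<^bsub>?Q\<^esub> a \<otimes>\<^bsub>?Q\<^esub> inv\<^bsub>?Q\<^esub> ?P w = ?P (w \<otimes> x \<otimes> inv w)"
        using x xS assms by (simp only: P_mult P_inv S.m_closed S.m_inv_closed)
      ultimately show ?thesis by blast
    qed
    show "x \<in> ?P ` D \<or> (\<exists>a\<in>?P ` D. x = a \<otimes>\<^bsub>?Q\<^esub> ?P w)" if x: "x \<in> carrier ?Q" for x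
    proof -
      from x obtain s where s: "s \<in> S" "x = ?P s" by (auto simp: carrier_FactGroup)
      from coverS[OF s(1)] show ?thesis
      proof
        assume "\<exists>a\<in>D. s = a \<otimes> w"
        then obtain a where "a \<in> D" "s = a \<otimes> w" by blast
        then show ?thesis using s P_mult[of a w] assms d(3) by auto
      qed (use s in blast)
    qed
  qed
  moreover have "derived ?Q (carrier ?Q) = ?P ` derived G S"
  proof -
    have "carrier ?Q = ?P ` S" by (simp add: carrier_FactGroup)
    then show ?thesis
      using P.derived_img[of S] derived_consistent[OF _ d(1), of S] by simp
  qed
  \<comment> \<open>This image is counted in two ways below: its fibres in
    \<open>derived G S\<close> are cosets of \<open>?K\<close>, and its fibres in \<open>D\<close>
    are cosets of the subgroup of all \<open>d\<close> with \<open>comm d w\<close> in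
    \<open>?K\<close>.\<close>
  ultimately have img: "?P ` derived G S = (\<lambda>d. ?P (comm d w)) ` D"
    using P_comm assms d(3) by (auto simp: image_image subset_iff intro!: image_cong)
  have dS: "derived G S \<subseteq> S" using derived_subset[OF d(1)] .
  have "card (derived G S) = card (?P ` derived G S) * card ?K"
  proof (rule card_fibres)
    show "subgroup (derived G S) G" using derived_is_subgroup S.subset by blast
    show "finite (derived G S)" using dS assms finite_subset by blast
    show "?K \<subseteq> derived G S" by (rule mono_derived[OF d(3)])
    show "?P s = ?P t \<longleftrightarrow> inv s \<otimes> t \<in> ?K" if "s \<in> derived G S" "t \<in> derived G S" for s t
      using P_eq[of s t] dS that by blast
  qed
  moreover have "card D = card ((\<lambda>d. ?P (comm d w)) ` D) * card {d \<in> D. comm d w \<in> ?K}"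
  proof (rule card_fibres)
    fix s t assume st: "s \<in> D" "t \<in> D"
    then have stS: "s \<in> S" "t \<in> S" using d(3) by auto
    have "?P (comm s w) = ?P (comm t w) \<longleftrightarrow>
        (inv\<^bsub>?Q\<^esub> ?P s \<otimes>\<^bsub>?Q\<^esub> ?P t) \<otimes>\<^bsub>?Q\<^esub> ?P w = ?P w \<otimes>\<^bsub>?Q\<^esub> (inv\<^bsub>?Q\<^esub> ?P s \<otimes>\<^bsub>?Q\<^esub> ?P t)"
      using Q.comm_left_eq_iff P_comm stS assms P_closed by simp
    also have "inv\<^bsub>?Q\<^esub> ?P s \<otimes>\<^bsub>?Q\<^esub> ?P t = ?P (inv s \<otimes> t)"
      using stS P_mult P_inv by simp
    also have "?P (inv s \<otimes> t) \<otimes>\<^bsub>?Q\<^esub> ?P w = ?P w \<otimes>\<^bsub>?Q\<^esub> ?P (inv s \<otimes> t) \<longleftrightarrow>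
        Q.comm (?P (inv s \<otimes> t)) (?P w) = \<one>\<^bsub>?Q\<^esub>"
      using Q.comm_eq_one_iff[OF P_closed P_closed] stS assms by blast
    also have "\<dots> \<longleftrightarrow> comm (inv s \<otimes> t) w \<in> ?K"
      using P_comm[of "inv s \<otimes> t" w] P_one[of "comm (inv s \<otimes> t) w"] stS assms
      by (simp add: comm_def)
    finally show "?P (comm s w) = ?P (comm t w) \<longleftrightarrow> inv s \<otimes> t \<in> {d \<in> D. comm d w \<in> ?K}"
      using st by simp
  qed (use d(2) finite_subset[OF d(3) assms(2)] in auto)
  ultimately show ?thesis using img by simp
qed

lemma cent_subset_commuting_mod_derived:
  assumes "subgroup D G" "w \<in> carrier G"
  shows "cent D w \<subseteq> {d \<in> D. comm d w \<in> derived G D}"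
proof
  interpret D: subgroup D G by fact
  fix s assume "s \<in> cent D w"
  then have s: "s \<in> D" "comm s w = \<one>"
    using assms comm_eq_one_iff[of s w] by (auto simp: cent_def)
  have "\<one> \<in> derived G D" unfolding derived_def by (rule generate.one)
  then show "s \<in> {d \<in> D. comm d w \<in> derived G D}" using s by simp
qed

text \<open>The centralizer \<open>cent D w\<close> lies in the subgroup occurring in
  \<open>card_derived_index_two\<close>, whose index in \<open>D\<close> is therefore at most
  \<open>class_size D w\<close>.\<close>

lemma card_derived_le_class_size:
  assumes "index_two D S" "finite S" "w \<in> S" "w \<notin> D"
  shows "card (derived G S) \<le> class_size D w * card (derived G D)"
proof -
  note d = index_twoD[OF assms(1)]
  interpret S: subgroup S G by (rule d)
  interpret D: subgroup D G by (rule d)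
  interpret K: subgroup "derived G D" G using derived_is_subgroup D.subset by blast
  have fin: "finite D" using assms d(3) finite_subset by blast
  let ?X = "{d \<in> D. comm d w \<in> derived G D}"
  have sub: "cent D w \<subseteq> ?X"
    using cent_subset_commuting_mod_derived[OF d(2)] assms by simp
  have "card (derived G S) * card ?X = class_size D w * card (cent D w) * card (derived G D)"
    using card_derived_index_two[OF assms] card_eq_class_size_cent[OF d(2) fin] assms by simp
  also have "\<dots> \<le> class_size D w * card ?X * card (derived G D)"
    using sub fin by (intro mult_right_mono mult_left_mono card_mono) auto
  finally have "card (derived G S) * card ?X \<le> class_size D w * card (derived G D) * card ?X"
    by (simp add: ac_simps)
  moreover have "card ?X > 0"
    using commuting_mod_derived_subgroup[OF assms(1,3)] fin
    by (auto simp: card_gt_0_iff dest: subgroup.one_closed)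
  ultimately show ?thesis by simp
qed

lemma class_size_pos: "subgroup S G \<Longrightarrow> finite S \<Longrightarrow> 0 < class_size S x"
  unfolding class_size_def card_gt_0_iff using subgroup.one_closed by fast

lemma card_derived_commutative:
  assumes S: "subgroup S G" and ab: "\<And>x y. x \<in> S \<Longrightarrow> y \<in> S \<Longrightarrow> x \<otimes> y = y \<otimes> x"
  shows "card (derived G S) = 1"
proof -
  interpret S: subgroup S G by (rule S)
  have "comm x y = \<one>" if "x \<in> S" "y \<in> S" for x y
    using ab that comm_eq_one_iff S.mem_carrier by blast
  then have "derived_set G S \<subseteq> {\<one>}" by (auto simp: comm_def)
  then have "derived G S \<subseteq> {\<one>}"
    unfolding derived_def by (rule generate_subgroup_incl[OF _ triv_subgroup])
  moreover have "\<one> \<in> derived G S" unfolding derived_def by (rule generate.one)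
  ultimately have "derived G S = {\<one>}" by blast
  then show ?thesis by simp
qed

lemma index_two_outside:
  assumes "index_two D S" "index_two E S" "D \<noteq> E"
  obtains x where "x \<in> S" "x \<notin> D" "x \<notin> E"
proof -
  note d = index_twoD[OF assms(1)] and e = index_twoD[OF assms(2)]
  obtain x where x: "x \<in> D" "x \<notin> E" using index_twoD(3,4)[OF index_two_Int[OF assms]] by blast
  obtain y where y: "y \<in> E" "y \<notin> D" using index_twoD(3,4)[OF index_two_Int[OF assms(2,1)]] assms(3) by blast
  have "x \<in> S" "y \<in> S" using x y d(3) e(3) by auto
  then have "x \<otimes> y \<in> S" "x \<otimes> y \<notin> D" "x \<otimes> y \<notin> E"
    using x y d(5) e(5) subgroup.m_closed[OF d(1)] by auto
  then show thesis by (rule that)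
qed

end

section \<open>Finite 2-groups: the exponent of the bound, growth of normalizers, index-two
  subgroups\<close>

text \<open>The exponent in the theorem. Truncated subtraction gives \<open>triangle 0 = 0\<close>,
  so the recursion \<open>triangle_Suc\<close> holds from zero on.\<close>

definition triangle :: "nat \<Rightarrow> nat" where "triangle n = n * (n - 1) div 2"

lemma triangle_Suc: "triangle (Suc n) = n + triangle n"
proof (cases n)
  case (Suc k)
  have "Suc n * n = n * 2 + n * (n - 1)" using Suc by (simp add: algebra_simps)
  then have "Suc n * n div 2 = (n * (n - 1) + n * 2) div 2" by (simp add: add.commute)
  then show ?thesis by (simp add: triangle_def)
qed (simp add: triangle_def)

lemma even_of_dvd_two_power:
  fixes m :: nat
  assumes "m dvd 2 ^ k" "m \<noteq> 1"
  shows "even m"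
  using assms divides_primepow_nat[OF two_is_prime_nat, of m k] by (metis even_power even_numeral neq0_conv power_0)

locale finite_two_group = group G for G (structure) +
  assumes fin: "finite (carrier G)" and two: "\<exists>k::nat. card (carrier G) = 2 ^ k"
begin

lemma finite_subgroup: "subgroup S G \<Longrightarrow> finite S"
  using fin finite_subset subgroup.subset by blast

lemma card_subgroup:
  assumes "subgroup S G"
  obtains a where "card S = 2 ^ a"
proof -
  have "card S dvd card (carrier G)"
    using lagrange[OF assms] by (metis dvd_triv_right order_def)
  then show ?thesis
    using two that divides_primepow_nat[OF two_is_prime_nat] by metis
qed

text \<open>Normalizers grow in a 2-group. A coset \<open>L x\<close> fixed by \<open>D\<close>
  means that \<open>inv x\<close> conjugates \<open>D\<close> into itself, so a fixed coset other
  than \<open>D\<close> yields the element sought.\<close>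

lemma normalizes_proper_subgroup:
  assumes S: "subgroup S G" and D: "subgroup D G" "D \<subset> S"
  shows "\<exists>x\<in>S - D. \<forall>d\<in>D. x \<otimes> d \<otimes> inv x \<in> D"
proof (rule ccontr)
  assume neg: "\<not> ?thesis"
  interpret S: subgroup S G by (rule S)
  interpret D: subgroup D G by (rule D)
  define L where "L x = {y \<in> S. inv x \<otimes> y \<in> D}" for x
  \<comment> \<open>\<open>D\<close> acts on the left cosets \<open>L x\<close> of \<open>D\<close>; were \<open>{D}\<close> the only orbit of size one, the index would be odd.\<close>
  define Orb where "Orb x = (\<lambda>d. L (d \<otimes> x)) ` D" for x
  have L_eq: "L x = L y \<longleftrightarrow> inv x \<otimes> y \<in> D" if "x \<in> S" "y \<in> S" for x y
  proof
    assume "L x = L y"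
    moreover have "y \<in> L y" using that by (simp add: L_def)
    ultimately have "y \<in> L x" by blast
    then show "inv x \<otimes> y \<in> D" by (simp add: L_def)
  next
    assume xy: "inv x \<otimes> y \<in> D"
    have "inv x \<otimes> z \<in> D \<longleftrightarrow> inv y \<otimes> z \<in> D" if z: "z \<in> S" for z
    proof -
      have "inv x \<otimes> z = (inv x \<otimes> y) \<otimes> (inv y \<otimes> z)" "inv y \<otimes> z = inv (inv x \<otimes> y) \<otimes> (inv x \<otimes> z)"
        using \<open>x \<in> S\<close> \<open>y \<in> S\<close> z by (simp_all add: group_word)
      then show ?thesis using xy D.m_closed D.m_inv_closed by metis
    qed
    then show "L x = L y" by (auto simp: L_def)
  qed
  obtain a where a: "card D = 2 ^ a" using card_subgroup D(1) .
  obtain b where b: "card S = 2 ^ b" using card_subgroup S .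
  have "card D < card S" using D finite_subgroup[OF S] by (intro psubset_card_mono)
  moreover have "card S = card (L ` S) * card D"
    by (rule card_fibres[OF S finite_subgroup[OF S]]) (use D L_eq in auto)
  ultimately have "card (L ` S) dvd 2 ^ b" "card (L ` S) \<noteq> 1"
    using b by (auto simp: dvd_def)
  then have L_even: "even (card (L ` S))" by (rule even_of_dvd_two_power)
  have Orb_even: "even (card (Orb x))" if x: "x \<in> S" "x \<notin> D" for x
  proof -
    let ?K = "{d \<in> D. inv x \<otimes> d \<otimes> x \<in> D}"
    have "card D = card (Orb x) * card ?K"
      unfolding Orb_def
    proof (rule card_fibres[OF D(1) finite_subgroup[OF D(1)]])
      fix s t assume st: "s \<in> D" "t \<in> D"
      then have "L (s \<otimes> x) = L (t \<otimes> x) \<longleftrightarrow> inv (s \<otimes> x) \<otimes> (t \<otimes> x) \<in> D"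
        using x D by (intro L_eq) auto
      also have "inv (s \<otimes> x) \<otimes> (t \<otimes> x) = inv x \<otimes> (inv s \<otimes> t) \<otimes> x"
        using st x by (simp add: group_word)
      finally show "L (s \<otimes> x) = L (t \<otimes> x) \<longleftrightarrow> inv s \<otimes> t \<in> ?K" using st by simp
    qed auto
    moreover have "?K \<noteq> D"
    proof
      assume "?K = D"
      then have "inv x \<otimes> d \<otimes> inv (inv x) \<in> D" if "d \<in> D" for d using that x by auto
      moreover have "inv x \<notin> D" using x D.m_inv_closed[of "inv x"] by auto
      ultimately show False using neg x by blast
    qed
    then have "card ?K < card D" using finite_subgroup[OF D(1)] by (intro psubset_card_mono) auto
    ultimately have "card (Orb x) dvd 2 ^ a" "card (Orb x) \<noteq> 1"
      using a by (auto simp: dvd_def)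
    then show ?thesis by (rule even_of_dvd_two_power)
  qed
  have Orb_D: "Orb x = {D}" if "x \<in> D" for x
  proof -
    have "L (d \<otimes> x) = L \<one>" if "d \<in> D" for d
      using L_eq[of "d \<otimes> x" \<one>] \<open>x \<in> D\<close> that D by auto
    moreover have "L \<one> = D" using D by (auto simp: L_def)
    ultimately have "Orb x = (\<lambda>d. D) ` D" unfolding Orb_def by (intro image_cong) simp_all
    then show ?thesis using image_constant[OF D.one_closed] by simp
  qed
  have LO: "L x \<in> Orb x" if "x \<in> S" for x
    unfolding Orb_def using that by (intro image_eqI[of _ _ \<one>]) auto
  have Orb_eq: "Orb x = Orb y" if "x \<in> S" "y \<in> S" "Orb x \<inter> Orb y \<noteq> {}" for x y
  proof -
    note xy = that
    \<comment> \<open>Translation by \<open>f \<otimes> inv d\<close> carries the common coset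
      \<open>L (d \<otimes> u)\<close>, which is \<open>L (e \<otimes> v)\<close>, to
      \<open>L (f \<otimes> u)\<close>. So orbits that share a coset contain each other.\<close>
    have sub: "Orb u \<subseteq> Orb v" if uv: "u \<in> S" "v \<in> S" "d \<in> D" "e \<in> D" "L (d \<otimes> u) = L (e \<otimes> v)" for u v d e
    proof
      fix c assume "c \<in> Orb u"
      then obtain f where f: "f \<in> D" "c = L (f \<otimes> u)" by (auto simp: Orb_def)
      have S': "d \<in> S" "e \<in> S" "f \<in> S" using uv f D by auto
      have "inv (d \<otimes> u) \<otimes> (e \<otimes> v) \<in> D" using L_eq[of "d \<otimes> u" "e \<otimes> v"] uv S' by auto
      also have "inv (d \<otimes> u) \<otimes> (e \<otimes> v) = inv (f \<otimes> u) \<otimes> ((f \<otimes> inv d \<otimes> e) \<otimes> v)"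
        using uv S' by (simp add: group_word)
      finally have "c = L ((f \<otimes> inv d \<otimes> e) \<otimes> v)"
        using L_eq[of "f \<otimes> u" "(f \<otimes> inv d \<otimes> e) \<otimes> v"] f uv S' by auto
      then show "c \<in> Orb v" using f uv unfolding Orb_def by blast
    qed
    obtain d e where "d \<in> D" "e \<in> D" "L (d \<otimes> x) = L (e \<otimes> y)"
      using xy(3) by (auto simp: Orb_def)
    then show ?thesis using sub[of x y d e] sub[of y x e d] xy(1,2) by auto
  qed
  have "\<Union> (Orb ` S) = L ` S"
  proof
    show "\<Union> (Orb ` S) \<subseteq> L ` S" unfolding Orb_def using D by auto
    show "L ` S \<subseteq> \<Union> (Orb ` S)" using LO by blast
  qed
  moreover have "card (\<Union> (Orb ` S)) = sum card (Orb ` S)"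
  proof (rule card_Union_disjoint)
    show "disjoint (Orb ` S)" using Orb_eq by (auto simp: disjoint_def pairwise_def disjnt_def)
    show "finite A" if "A \<in> Orb ` S" for A
      using that finite_subgroup[OF D(1)] by (auto simp: Orb_def)
  qed
  moreover have "sum card (Orb ` S) = card {D} + sum card (Orb ` S - {{D}})"
  proof (rule sum.remove)
    show "finite (Orb ` S)" using finite_subgroup[OF S] by simp
    show "{D} \<in> Orb ` S" using Orb_D by (intro image_eqI[of _ _ \<one>]) simp_all
  qed
  moreover have "even (sum card (Orb ` S - {{D}}))"
    using Orb_even Orb_D by (intro dvd_sum) auto
  ultimately show False using L_even by simp
qed

text \<open>A largest proper subgroup \<open>D\<close> containing \<open>H\<close> is normalized by
  some \<open>x\<close> outside it. A suitable power \<open>a\<close> of \<open>x\<close> has its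
  square in \<open>D\<close>; then \<open>D\<close> and its coset of \<open>a\<close> form a
  subgroup, which must be \<open>S\<close>.\<close>

lemma index_two_extending:
  assumes S: "subgroup S G" and H: "subgroup H G" "H \<subset> S"
  obtains D where "index_two D S" "H \<subseteq> D"
proof -
  interpret S: subgroup S G by (rule S)
  let ?P = "\<lambda>D. subgroup D G \<and> H \<subseteq> D \<and> D \<subset> S"
  have "\<exists>D. ?P D \<and> (\<forall>E. ?P E \<longrightarrow> card E \<le> card D)"
  proof (rule Lattices_Big.ex_has_greatest_nat[of ?P H card "Suc (card S)"])
    show "?P H" using H by blast
    show "\<forall>E. ?P E \<longrightarrow> card E < Suc (card S)"
      using finite_subgroup[OF S] by (auto simp: less_Suc_eq_le intro!: card_mono)
  qed
  then obtain D where D: "subgroup D G" "H \<subseteq> D" "D \<subset> S"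
    and max: "\<And>E. ?P E \<Longrightarrow> card E \<le> card D" by blast
  interpret D: subgroup D G by (rule D)
  obtain x where x: "x \<in> S" "x \<notin> D" and conj: "\<And>d. d \<in> D \<Longrightarrow> x \<otimes> d \<otimes> inv x \<in> D"
    using normalizes_proper_subgroup[OF S D(1,3)] by blast
  have conj_pow: "x [^] k \<otimes> d \<otimes> inv (x [^] k) \<in> D" if "d \<in> D" for k :: nat and d
    using that
  proof (induction k arbitrary: d)
    case (Suc k)
    from Suc.IH[OF conj[OF Suc.prems]] show ?case
      using x(1) Suc.prems by (simp add: group_word)
  qed simp
  \<comment> \<open>The order of \<open>G\<close> is a power of two and annihilates
    \<open>x\<close>. For the least such \<open>n\<close>, which is positive, the power with
    exponent \<open>2 ^ (n - 1)\<close> is outside \<open>D\<close> and its square inside.\<close>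
  have "\<exists>n. x [^] (2 ^ n :: nat) \<in> D"
    using two pow_order_eq_1[of x] x(1) by (metis D.one_closed S.mem_carrier order_def)
  then obtain n where n: "x [^] (2 ^ n :: nat) \<in> D" "\<And>i. i < n \<Longrightarrow> x [^] (2 ^ i :: nat) \<notin> D"
    using exists_least_iff[of "\<lambda>n. x [^] (2 ^ n :: nat) \<in> D"] by auto
  have "n \<noteq> 0"
  proof
    assume "n = 0"
    then show False using n(1) x by simp
  qed
  define a where "a = x [^] (2 ^ (n - 1) :: nat)"
  have aS: "a \<in> S" 
  proof -
    have "x [^] k \<in> S" for k :: nat by (induction k) (use x(1) in auto)
    then show ?thesis by (simp add: a_def)
  qed
  have aD: "a \<notin> D" using n(2)[of "n - 1"] \<open>n \<noteq> 0\<close> by (simp add: a_def)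
  have "a \<otimes> a = x [^] (2 ^ n :: nat)"
    using x(1) \<open>n \<noteq> 0\<close> unfolding a_def
    by (simp add: nat_pow_mult flip: mult_2 power_Suc)
  then have aa: "a \<otimes> a \<in> D" using n by simp
  have conj_a: "a \<otimes> d \<otimes> inv a \<in> D" if "d \<in> D" for d
    unfolding a_def by (rule conj_pow[OF that])
  have prod: "(d \<otimes> a) \<otimes> (e \<otimes> a) \<in> D" if "d \<in> D" "e \<in> D" for d e
  proof -
    have "(d \<otimes> a) \<otimes> (e \<otimes> a) = d \<otimes> (a \<otimes> e \<otimes> inv a) \<otimes> (a \<otimes> a)"
      using that aS by (simp add: group_word)
    then show ?thesis using that conj_a aa by simp
  qed
  let ?E = "D \<union> (\<lambda>d. d \<otimes> a) ` D"
  have "subgroup ?E G"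
  proof (rule subgroupI)
    show "?E \<subseteq> carrier G" using aS by auto
    show "?E \<noteq> {}" using D.one_closed by blast
  next
    fix y assume "y \<in> ?E"
    then consider "y \<in> D" | d where "d \<in> D" "y = d \<otimes> a" by blast
    then show "inv y \<in> ?E"
    proof cases
      case 2
      have "inv y = inv (a \<otimes> a) \<otimes> (a \<otimes> inv d \<otimes> inv a) \<otimes> a"
        using 2 aS by (simp add: group_word)
      then show ?thesis using 2 conj_a[of "inv d"] aa by blast
    qed simp
  next
    fix y z assume yz: "y \<in> ?E" "z \<in> ?E"
    have 1: "(d \<otimes> a) \<otimes> e \<in> (\<lambda>d. d \<otimes> a) ` D" if "d \<in> D" "e \<in> D" for d e
    proof -
      have "(d \<otimes> a) \<otimes> e = (d \<otimes> (a \<otimes> e \<otimes> inv a)) \<otimes> a" using that aS by (simp add: group_word)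
      then show ?thesis using that conj_a by blast
    qed
    have 2: "e \<otimes> (d \<otimes> a) \<in> (\<lambda>d. d \<otimes> a) ` D" if "d \<in> D" "e \<in> D" for d e
    proof -
      have "e \<otimes> (d \<otimes> a) = (e \<otimes> d) \<otimes> a" using that aS by (simp add: group_word)
      then show ?thesis using that by blast
    qed
    show "y \<otimes> z \<in> ?E"
    proof (cases "y \<in> D")
      case True
      then show ?thesis using yz(2) 2 by auto
    next
      case False
      then show ?thesis using yz 1 prod by auto
    qed
  qed
  moreover have "a \<in> ?E" using aS D.one_closed by (metis S.mem_carrier UnI2 imageI l_one)
  moreover have "?E \<subseteq> S" using aS D(3) by auto
  moreover have "card D < card ?E"
    using calculation aD finite_subgroup by (intro psubset_card_mono) auto
  ultimately have E: "?E = S"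
    using max[of ?E] D(2) by (metis le_supI1 not_le psubsetI)
  have "x \<otimes> y \<in> D \<longleftrightarrow> (x \<in> D \<longleftrightarrow> y \<in> D)" if "x \<in> S" "y \<in> S" for x y
  proof -
    have 1: "u \<otimes> v \<in> D \<longleftrightarrow> v \<in> D" if "u \<in> D" "v \<in> S" for u v
    proof
      assume "u \<otimes> v \<in> D"
      moreover have "v = inv u \<otimes> (u \<otimes> v)" using that by (simp add: group_word)
      ultimately show "v \<in> D" using that D.m_closed D.m_inv_closed by metis
    qed (use that in simp)
    have 2: "v \<otimes> u \<in> D \<longleftrightarrow> v \<in> D" if "u \<in> D" "v \<in> S" for u v
    proof
      assume "v \<otimes> u \<in> D"
      moreover have "v = (v \<otimes> u) \<otimes> inv u" using that by (simp add: m_assoc)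
      ultimately show "v \<in> D" using that D.m_closed D.m_inv_closed by metis
    qed (use that in simp)
    have "x \<otimes> y \<in> D" if "x \<notin> D" "y \<notin> D"
      using \<open>x \<in> S\<close> \<open>y \<in> S\<close> that E prod by blast
    then show ?thesis using 1[of x y] 2[of y x] that by blast
  qed
  then have "index_two D S" unfolding index_two_def using S D(3) by blast
  then show thesis using that D(2) by blast
qed

text \<open>Passes from the numerical index to the sign-character form: by cardinality
  \<open>E\<close> equals an index-two subgroup that contains it.\<close>

lemma index_two_of_card:
  assumes "subgroup S G" "subgroup E G" "E \<subseteq> S" "card S = 2 * card E"
  shows "index_two E S"
proof -
  have "card E > 0" using finite_subgroup[OF assms(2)] assms(2) card_gt_0_iff subgroup_nonempty by metis
  then have "E \<subset> S" using assms by auto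
  then obtain D where D: "index_two D S" "E \<subseteq> D"
    using index_two_extending[OF assms(1,2)] by blast
  then have "card D = card E" using card_index_two finite_subgroup assms by fastforce
  then have "E = D" using D index_twoD(2)[OF D(1)] finite_subgroup card_subset_eq by metis
  then show ?thesis using D by simp
qed

section \<open>The exceptional case of two distinct index-two subgroups\<close>

text \<open>The strict bound leaves room for the factor two between the derived subgroups of
  \<open>D\<close> and \<open>S\<close>. Here \<open>IH\<close> is the induction hypothesis for a
  single avoided subgroup. If the bound failed, a subgroup \<open>C\<close> of \<open>Y\<close>
  would centralize \<open>E\<close>; the contradiction depends on whether \<open>C\<close> lies in
  \<open>F\<close>.\<close>

lemma card_derived_less:
  assumes IH: "\<And>S H n. subgroup S G \<Longrightarrow> card S < card D \<Longrightarrow> subgroup H G \<Longrightarrow> H \<subset> S \<Longrightarrow>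
      (\<And>x. x \<in> S \<Longrightarrow> x \<notin> H \<Longrightarrow> class_size S x < 2 ^ n) \<Longrightarrow> card (derived G S) \<le> 2 ^ triangle n"
    and K: "index_two K D" and E: "index_two E D" "E \<noteq> K"
    and bK: "\<And>y. y \<in> D \<Longrightarrow> y \<notin> K \<Longrightarrow> class_size D y \<le> 2 ^ m"
    and bE: "\<And>y. y \<in> D \<Longrightarrow> y \<notin> K \<Longrightarrow> y \<notin> E \<Longrightarrow> class_size D y < 2 ^ m"
  shows "card (derived G D) < 2 ^ triangle (Suc m)"
proof (rule ccontr)
  assume "\<not> ?thesis"
  then have big: "2 ^ m * 2 ^ triangle m \<le> card (derived G D)" by (simp add: triangle_Suc power_add)
  define F where "F = E \<inter> K"
  define Y where "Y = E \<inter> K \<union> (D - (E \<union> K))"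
  have Y: "index_two Y D" unfolding Y_def by (rule index_two_third[OF E(1) K E(2)])
  have FE: "index_two F E" unfolding F_def by (rule index_two_Int[OF E(1) K E(2)])
  obtain z where z: "z \<in> D" "z \<notin> E" "z \<notin> K" using index_two_outside[OF E(1) K E(2)] .
  have "Y \<noteq> E" using z by (auto simp: Y_def)
  then have "index_two (Y \<inter> E) Y" by (rule index_two_Int[OF Y E(1)])
  moreover have "Y \<inter> E = F" by (auto simp: Y_def F_def)
  ultimately have FY: "index_two F Y" by simp
  note dE = index_twoD[OF E(1)] and dY = index_twoD[OF Y] and dFE = index_twoD[OF FE] and dFY = index_twoD[OF FY]
  interpret D: subgroup D G by (rule dE)
  interpret E: subgroup E G by (rule dE)
  interpret Y: subgroup Y G by (rule dY)
  interpret F: subgroup F G by (rule dFE)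
  interpret dY: subgroup "derived G Y" G using derived_is_subgroup Y.subset by blast
  have fD: "finite D" and fE: "finite E" and fY: "finite Y" and fF: "finite F"
    using finite_subgroup dE dY dFE by auto
  have cards: "card D = 2 * card Y" "card D = 2 * card E" "card Y = 2 * card F" "card E = 2 * card F"
    using card_index_two Y E FY FE fD fY fE by auto
  have cF: "card F > 0" using fF F.one_closed card_gt_0_iff by blast
  \<comment> \<open>Elements of \<open>Y - F\<close> avoid \<open>E\<close> and \<open>K\<close>, so
    the strict bound \<open>bE\<close> applies to them. Elements of \<open>E - F\<close> avoid
    \<open>K\<close> and \<open>Y\<close>, so each can play the part of \<open>w\<close> for
    \<open>Y\<close> in \<open>D\<close>.\<close>
  have YF: "y \<in> D \<and> y \<notin> K \<and> y \<notin> E" if "y \<in> Y" "y \<notin> F" for y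
    using that by (auto simp: Y_def F_def)
  have EF: "y \<in> D \<and> y \<notin> K \<and> y \<notin> Y" if "y \<in> E" "y \<notin> F" for y
    using that dE(3) by (auto simp: Y_def F_def)
  have bY: "class_size Y y < 2 ^ m" if "y \<in> Y" "y \<notin> F" for y
    using YF[OF that] bE class_size_mono[OF fD dY(3), of y] by (meson le_less_trans)
  have derY: "card (derived G Y) \<le> 2 ^ triangle m"
    by (rule IH[OF dY(2) _ dFY(2) _ bY]) (use dFY(3,4) cards cF in auto)
  \<comment> \<open>The assumption forces equality in \<open>|D'| \<le> 2\<^sup>m |Y'|\<close>, computed with any \<open>x \<in> E - F\<close>.\<close>
  have key: "{v \<in> Y. comm v x \<in> derived G Y} = cent Y x" "class_size Y x = 2 ^ m"
    "card (derived G Y) = 2 ^ triangle m" if x: "x \<in> E" "x \<notin> F" for x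
  proof -
    let ?X = "{v \<in> Y. comm v x \<in> derived G Y}"
    let ?c = "card (cent Y x)"
    note xD = EF[OF x]
    have class_size: "class_size Y x \<le> 2 ^ m" using bK[of x] xD class_size_mono[OF fD dY(3), of x] by simp
    have sub: "cent Y x \<subseteq> ?X"
      using cent_subset_commuting_mod_derived[OF dY(2)] x by simp
    have cY: "card Y = class_size Y x * ?c" using card_eq_class_size_cent[OF dY(2) fY] x by simp
    have pos: "?c > 0" using cent_subgroup[OF dY(2)] x finite_subgroup
      by (metis E.mem_carrier card_gt_0_iff subgroup_nonempty)
    have "2 ^ m * 2 ^ triangle m * card ?X \<le> card (derived G D) * card ?X" using big by simp
    also have "\<dots> = class_size Y x * ?c * card (derived G Y)"
      using card_derived_index_two[OF Y fD, of x] xD cY by simp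
    finally have main: "2 ^ m * 2 ^ triangle m * card ?X \<le> class_size Y x * ?c * card (derived G Y)" .
    also have "\<dots> \<le> 2 ^ m * ?c * 2 ^ triangle m" using class_size derY by (intro mult_mono) auto
    finally have "card ?X \<le> ?c" by simp
    then show eq: "?X = cent Y x" using sub fY by (intro card_seteq[symmetric]) auto
    from main have *: "2 ^ m * 2 ^ triangle m \<le> class_size Y x * card (derived G Y)"
      unfolding eq using pos by (simp add: ac_simps)
    also have "\<dots> \<le> class_size Y x * 2 ^ triangle m" using derY by simp
    finally show 1: "class_size Y x = 2 ^ m" using class_size by simp
    show "card (derived G Y) = 2 ^ triangle m" using * 1 derY by simp
  qed
  obtain x where x: "x \<in> E" "x \<notin> F" using dFE(3,4) by blast
  define C where "C = cent Y x"
  have C: "subgroup C G" unfolding C_def using cent_subgroup[OF dY(2)] x by simp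
  interpret C: subgroup C G by (rule C)
  have CY: "C \<subseteq> Y" by (auto simp: C_def cent_def)
  have cY: "card Y = 2 ^ m * card C"
    using card_eq_class_size_cent[OF dY(2) fY, of x] x key(2)[OF x] by (simp add: C_def)
  \<comment> \<open>Since \<open>y = x \<otimes> f\<close> with \<open>f\<close> in
    \<open>Y\<close>, the commutators of \<open>v\<close> with \<open>y\<close> and with
    \<open>x\<close> agree modulo \<open>derived G Y\<close>. By \<open>key\<close>, commuting
    modulo \<open>derived G Y\<close> is commuting.\<close>
  have C_eq: "cent Y y = C" if y: "y \<in> E" "y \<notin> F" for y
  proof -
    define f where "f = inv x \<otimes> y"
    have f: "f \<in> F" using dFE(5,6) x y by (simp add: f_def)
    then have fY: "f \<in> Y" using dFY(3) by blast
    have xf: "y = x \<otimes> f" using x y by (simp add: f_def group_word)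
    have "comm v y \<in> derived G Y \<longleftrightarrow> comm v x \<in> derived G Y" if v: "v \<in> Y" for v
    proof -
      let ?k = "x \<otimes> comm v f \<otimes> inv x"
      have k: "?k \<in> derived G Y"
        using index_two_conj_derived[OF Y _ comm_in_derived[OF v fY], of x] x dE(3) by blast
      have eq: "comm v y = comm v x \<otimes> ?k" using x f v by (simp add: xf comm_mult_right)
      have "comm v x = comm v y \<otimes> inv ?k" using x f v by (simp add: eq m_assoc)
      then show ?thesis using eq k dY.m_closed dY.m_inv_closed by metis
    qed
    then have "{v \<in> Y. comm v y \<in> derived G Y} = {v \<in> Y. comm v x \<in> derived G Y}" by blast
    then show ?thesis using key(1)[OF x] key(1)[OF y] by (simp add: C_def)
  qed
  \<comment> \<open>An element of \<open>F\<close> is a quotient of two elements of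
    \<open>E - F\<close>, and \<open>C\<close> commutes with those by \<open>C_eq\<close>.\<close>
  have central: "v \<otimes> g = g \<otimes> v" if v: "v \<in> C" and g: "g \<in> E" for v g
  proof (cases "g \<in> F")
    case False
    then have "v \<in> cent Y g" using C_eq g v by simp
    then show ?thesis by (simp add: cent_def)
  next
    case True
    have "x \<otimes> g \<in> E" "x \<otimes> g \<notin> F" using dFE(5) x g True by simp_all
    then have "v \<in> cent Y (x \<otimes> g)" using C_eq v by simp
    then have 1: "v \<otimes> (x \<otimes> g) = x \<otimes> g \<otimes> v" by (simp add: cent_def)
    have 2: "v \<otimes> x = x \<otimes> v" using v by (simp add: C_def cent_def)
    have "x \<otimes> (v \<otimes> g) = v \<otimes> x \<otimes> g" using v g x 2 by (simp add: m_assoc)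
    also have "\<dots> = x \<otimes> (g \<otimes> v)" using v g x 1 by (simp add: m_assoc)
    finally show ?thesis using v g x by simp
  qed
  \<comment> \<open>The class of \<open>z\<close> is nonempty but has fewer than
    \<open>2 ^ m\<close> elements.\<close>
  have "m \<noteq> 0" using bE[OF z(1,3,2)] class_size_pos[OF dE(1) fD, of z] by (cases m) auto
  then obtain p where p: "m = Suc p" using not0_implies_Suc by blast
  show False
  proof (cases "C \<subseteq> F")
    case True
    have cFC: "card F = 2 ^ p * card C" using cY cards(3) p by simp
    \<comment> \<open>The index of \<open>C\<close> in \<open>F\<close> is \<open>2 ^ p\<close>. An
      element \<open>f\<close> of \<open>F - C\<close> is centralized by \<open>C\<close> and by
      itself, so its class is smaller than that. If \<open>C = F\<close>, no proper subgroup is left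
      to avoid, but \<open>F\<close> is abelian.\<close>
    have derF: "card (derived G F) \<le> 2 ^ triangle p"
    proof (cases "C = F")
      case True
      then have "card (derived G F) = 1"
        using central dFE(3) by (intro card_derived_commutative dFE(2)) auto
      then show ?thesis by simp
    next
      case False
      show ?thesis
      proof (rule IH[OF dFE(2) _ C])
        fix f assume f: "f \<in> F" "f \<notin> C"
        have "C \<subset> cent F f"
          using f True central dFE(3) by (auto simp: cent_def)
        then have "card C < card (cent F f)"
          using fF by (intro psubset_card_mono) (auto simp: cent_def)
        then have "2 ^ p * card C < 2 ^ p * card (cent F f)" by simp
        moreover have "class_size F f * card (cent F f) = 2 ^ p * card C"
          using card_eq_class_size_cent[OF dFE(2) fF, of f] f cFC by simp
        ultimately have "class_size F f * card (cent F f) < 2 ^ p * card (cent F f)" by linarith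
        then show "class_size F f < 2 ^ p" by simp
      qed (use True False cards cF in auto)
    qed
    \<comment> \<open>So \<open>x\<close> has class size \<open>2 ^ p\<close> in \<open>F\<close>,
      which bounds \<open>derived G E\<close>. Passing from \<open>E\<close> to \<open>D\<close>
      with \<open>z\<close> then costs a factor below \<open>2 ^ m\<close>, against
      \<open>big\<close>.\<close>
    have "cent F x = C" using True dFY(3) by (auto simp: C_def cent_def)
    then have "card F = class_size F x * card C" using card_eq_class_size_cent[OF dFE(2) fF, of x] x by simp
    then have "class_size F x = 2 ^ p" using cFC cF by simp
    then have "card (derived G E) \<le> 2 ^ p * card (derived G F)"
      using card_derived_le_class_size[OF FE fE x] by simp
    also have "\<dots> \<le> 2 ^ triangle m" using derF by (simp add: p triangle_Suc power_add)
    finally have derE: "card (derived G E) \<le> 2 ^ triangle m" .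
    have "card (derived G D) \<le> class_size E z * card (derived G E)"
      by (rule card_derived_le_class_size[OF E(1) fD z(1,2)])
    also have "\<dots> \<le> class_size E z * 2 ^ triangle m" using derE by simp
    also have "\<dots> < 2 ^ m * 2 ^ triangle m"
      using bE[OF z(1,3,2)] class_size_mono[OF fD dE(3), of z] by simp
    finally show False using big by simp
  next
    case False
    then obtain t where t: "t \<in> C" "t \<notin> F" by blast
    have tY: "t \<in> Y" using t CY by blast
    note tD = YF[OF tY t(2)]
    \<comment> \<open>\<open>D\<close> is covered by \<open>E\<close> and its coset of
      \<open>t\<close>, and \<open>t\<close> commutes with \<open>E\<close> and with itself.\<close>
    have t_central: "t \<otimes> d = d \<otimes> t" if d: "d \<in> D" for d
    proof (cases "d \<in> E")
      case True
      then show ?thesis using central t by blast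
    next
      case False
      then have "inv t \<otimes> d \<in> E" using dE(5,6) tD d by simp
      then have "t \<otimes> (inv t \<otimes> d) = (inv t \<otimes> d) \<otimes> t" by (rule central[OF t(1)])
      then have "t \<otimes> (t \<otimes> (inv t \<otimes> d)) = t \<otimes> ((inv t \<otimes> d) \<otimes> t)" by simp
      then show ?thesis using d t by (simp add: group_word)
    qed
    \<comment> \<open>Multiplying by the central \<open>t\<close> leaves commutators unchanged and
      moves \<open>F\<close> into \<open>Y - F\<close>, where the strict bound holds.\<close>
    have bF: "class_size D f < 2 ^ m" if f: "f \<in> F" for f
    proof -
      have fD: "f \<in> D" using f dFE(3) dE(3) by blast
      have "comm s (t \<otimes> f) = comm s f" if s: "s \<in> D" for s
      proof -
        have "comm s t = \<one>" using t_central s t comm_eq_one_iff by simp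
        moreover have "t \<otimes> comm s f \<otimes> inv t = comm s f"
          using t_central[of "comm s f"] s fD t by (simp add: comm_def m_assoc)
        ultimately show ?thesis using s fD t by (simp add: comm_mult_right)
      qed
      then have "class_size D f = class_size D (t \<otimes> f)" unfolding class_size_def by (metis (no_types, lifting) image_cong)
      moreover have "t \<otimes> f \<in> Y" "t \<otimes> f \<notin> F" using dFY(3,5) tY f t by auto
      ultimately show ?thesis using bE YF by simp
    qed
    \<comment> \<open>No element of \<open>E - F\<close> commutes with \<open>f\<close>, since
      otherwise \<open>f\<close> would lie in its centralizer \<open>C\<close>. So the class of
      \<open>f\<close> doubles from \<open>F\<close> to \<open>E\<close>, and the bound
      \<open>2 ^ m\<close> halves on the way back.\<close>
    have bF': "class_size F f < 2 ^ p" if f: "f \<in> F" "f \<notin> C" for f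
    proof -
      have fY: "f \<in> Y" and fG: "f \<in> carrier G" using f dFY(3) by auto
      have "cent E f = cent F f"
      proof
        show "cent F f \<subseteq> cent E f" using dFE(3) by (auto simp: cent_def)
        show "cent E f \<subseteq> cent F f"
        proof
          fix y assume y: "y \<in> cent E f"
          then have yE: "y \<in> E" "f \<otimes> y = y \<otimes> f" by (auto simp: cent_def)
          have "y \<in> F"
          proof (rule ccontr)
            assume "y \<notin> F"
            then have "cent Y y = C" using C_eq yE by blast
            moreover have "f \<in> cent Y y" using fY yE by (simp add: cent_def)
            ultimately show False using f by blast
          qed
          then show "y \<in> cent F f" using yE by (simp add: cent_def)
        qed
      qed
      then have "card E = class_size E f * card (cent F f)"
        using card_eq_class_size_cent[OF dE(2) fE fG] by simp
      moreover have F: "card F = class_size F f * card (cent F f)"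
        by (rule card_eq_class_size_cent[OF dFE(2) fF fG])
      ultimately have "class_size E f * card (cent F f) = 2 * class_size F f * card (cent F f)"
        using cards(4) by linarith
      moreover have "card (cent F f) \<noteq> 0" using F cF by auto
      ultimately have "class_size E f = 2 * class_size F f" by simp
      then show ?thesis using bF[OF f(1)] class_size_mono[OF fD dE(3), of f] p by simp
    qed
    have "\<not> F \<subseteq> C"
    proof
      assume FC: "F \<subseteq> C"
      have "y \<in> C" if y: "y \<in> Y" for y
      proof (cases "y \<in> F")
        case False
        then have "inv t \<otimes> y \<in> F" using dFY(5,6) tY t y by simp
        then have "t \<otimes> (inv t \<otimes> y) \<in> C" using t FC by auto
        then show ?thesis using t y by (simp add: group_word)
      qed (use FC in blast)
      then have "C = Y" using CY by blast
      then have "card Y = 2 ^ m * card Y" using cY by simp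
      then show False using p cards cF by simp
    qed
    then obtain f where f: "f \<in> F" "f \<notin> C" by blast
    have "card (derived G F) \<le> 2 ^ triangle p"
    proof (rule IH[OF dFE(2)])
      show "subgroup (C \<inter> F) G" by (rule subgroups_Inter_pair[OF C dFE(2)])
    qed (use f bF' cards cF in auto)
    \<comment> \<open>With the central \<open>t\<close> as the element outside \<open>F\<close>, all
      commutators with it are trivial, so the derived subgroup does not grow from \<open>F\<close>
      to \<open>Y\<close>.\<close>
    moreover have "card (derived G Y) = card (derived G F)"
    proof -
      have "comm d t = \<one>" if "d \<in> F" for d
        using t_central[of d] that comm_eq_one_iff t dFE(3) dE(3) by auto
      moreover have "\<one> \<in> derived G F" unfolding derived_def by (rule generate.one)
      ultimately have "{d \<in> F. comm d t \<in> derived G F} = F" by auto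
      then show ?thesis using card_derived_index_two[OF FY fY tY t(2)] cF by simp
    qed
    \<comment> \<open>As \<open>triangle m = p + triangle p\<close>, only \<open>p = 0\<close>
      remains, and then the class of \<open>f\<close> would be empty.\<close>
    ultimately have "(2::nat) ^ triangle m \<le> 2 ^ triangle p" using key(3)[OF x] by simp
    then have "triangle m \<le> triangle p" by (simp add: power_increasing_iff)
    then have "p = 0" by (simp add: p triangle_Suc)
    then show False using bF'[OF f] class_size_pos[OF dFE(2) fF, of f] by simp
  qed
qed

section \<open>The induction on the order of \<open>S\<close>\<close>

text \<open>Class sizes divide the order of \<open>S\<close>, hence are powers of two.\<close>

lemma class_size_le_if_less:
  assumes "subgroup S G" "x \<in> carrier G" "class_size S x < 2 ^ Suc m"
  shows "class_size S x \<le> 2 ^ m"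
proof -
  obtain a where "card S = 2 ^ a" using card_subgroup assms(1) .
  then have "class_size S x dvd 2 ^ a"
    using card_eq_class_size_cent[OF assms(1) finite_subgroup[OF assms(1)] assms(2)] by (metis dvd_triv_left)
  then obtain b where b: "class_size S x = 2 ^ b" using divides_primepow_nat[OF two_is_prime_nat] by blast
  then have "b < Suc m" using assms(3) by (metis power_strict_increasing_iff one_less_numeral_iff semiring_norm(76))
  then show ?thesis using b by simp
qed

text \<open>Supplies the data of the induction step. Let \<open>H\<close> be of index two above
  \<open>H1\<close>. If \<open>H2\<close> is inside \<open>H\<close>, any second index-two subgroup
  serves as \<open>D\<close>; otherwise \<open>D\<close> is the third subgroup determined by
  \<open>H\<close> and some \<open>M\<close> above \<open>H2\<close>.\<close>

lemma index_two_avoiding: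
  assumes S: "subgroup S G" and H1: "subgroup H1 G" "H1 \<subset> S" and H2: "subgroup H2 G" "H2 \<subseteq> S"
    and small: "H2 \<subseteq> H1 \<or> 4 * card H2 \<le> card S"
    and nonabelian: "card (derived G S) \<noteq> 1"
  obtains D K w where "index_two D S" "index_two K D" "D \<inter> (H1 \<union> H2) \<subseteq> K"
    "w \<in> S" "w \<notin> D" "w \<notin> H1" "w \<notin> H2"
proof -
  interpret S: subgroup S G by (rule S)
  obtain H where H: "index_two H S" "H1 \<subseteq> H" using index_two_extending[OF S H1] .
  note dH = index_twoD[OF H(1)]
  show thesis
  proof (cases "H2 \<subseteq> H")
    case True
    \<comment> \<open>Elements outside \<open>H\<close> generate \<open>S\<close>, so in a
      nonabelian \<open>S\<close> they are not all central. An index-two subgroup above the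
      centralizer of a noncentral \<open>x\<close> outside \<open>H\<close> contains
      \<open>x\<close> and so differs from \<open>H\<close>.\<close>
    have "\<exists>x\<in>S - H. cent S x \<noteq> S"
    proof (rule ccontr)
      assume "\<not> ?thesis"
      then have out: "s \<otimes> x = x \<otimes> s" if "x \<in> S" "x \<notin> H" "s \<in> S" for x s
        using that by (auto simp: cent_def)
      obtain z where z: "z \<in> S" "z \<notin> H" using dH(3,4) by blast
      have "x \<otimes> y = y \<otimes> x" if xy: "x \<in> S" "y \<in> S" for x y
      proof (cases "x \<in> H")
        case True
        have zx: "z \<otimes> x \<in> S" "z \<otimes> x \<notin> H" using dH(5) z xy True by simp_all
        have "z \<otimes> (x \<otimes> y) = y \<otimes> (z \<otimes> x)" using out[OF zx xy(2)] z xy by (simp add: m_assoc)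
        also have "\<dots> = (y \<otimes> z) \<otimes> x" using z xy by (simp add: m_assoc)
        also have "\<dots> = z \<otimes> (y \<otimes> x)" using out[OF z xy(2)] z xy by (simp add: m_assoc)
        finally show ?thesis using z xy by simp
      qed (use out xy in simp)
      then show False using nonabelian card_derived_commutative[OF S] by blast
    qed
    then obtain x where x: "x \<in> S" "x \<notin> H" "cent S x \<noteq> S" by blast
    then have "cent S x \<subset> S" by (auto simp: cent_def)
    then obtain D where D: "index_two D S" "cent S x \<subseteq> D"
      using index_two_extending[OF S cent_subgroup[OF S]] x by (metis S.mem_carrier)
    then have DH: "D \<noteq> H" using x by (auto simp: cent_def)
    obtain w where "w \<in> S" "w \<notin> D" "w \<notin> H" using index_two_outside[OF D(1) H(1) DH] .
    then show thesis
      using that[of D "D \<inter> H" w] D(1) index_two_Int[OF D(1) H(1) DH] H(2) True by blast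
  next
    case False
    then have four: "4 * card H2 \<le> card S" using small H(2) by blast
    have pos: "0 < card H2" using H2(1) finite_subgroup card_gt_0_iff subgroup_nonempty by metis
    then have "H2 \<noteq> S" using four by auto
    then obtain M where M: "index_two M S" "H2 \<subseteq> M" using index_two_extending[OF S H2(1)] H2(2) by blast
    note dM = index_twoD[OF M(1)]
    have "card S = 2 * card M" using card_index_two[OF M(1) finite_subgroup[OF S]] .
    then have "card H2 \<noteq> card M" using four pos by linarith
    then have "H2 \<noteq> M" by blast
    have MH: "M \<noteq> H" using M(2) False by blast
    let ?D = "M \<inter> H \<union> (S - (M \<union> H))"
    have D: "index_two ?D S" by (rule index_two_third[OF M(1) H(1) MH])
    obtain z where "z \<in> S" "z \<notin> M" "z \<notin> H" using index_two_outside[OF M(1) H(1) MH] .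
    then have DH: "?D \<noteq> H" by blast
    obtain a where a: "a \<in> M" "a \<notin> H" using index_twoD(4)[OF index_two_Int[OF M(1) H(1) MH]] by blast
    obtain b where b: "b \<in> M" "b \<notin> H2" using M(2) \<open>H2 \<noteq> M\<close> by blast
    \<comment> \<open>\<open>M \<inter> H\<close> and \<open>H2\<close> are proper subgroups of
      \<open>M\<close> and cannot cover it. Since \<open>M\<close> meets \<open>?D\<close> inside
      \<open>H\<close>, such a \<open>w\<close> is also outside \<open>?D\<close>.\<close>
    have "\<exists>w\<in>M. w \<notin> H \<and> w \<notin> H2"
    proof (cases "a \<in> H2 \<and> b \<in> H")
      case True
      have "a \<otimes> b \<notin> H2"
      proof
        assume "a \<otimes> b \<in> H2"
        then have "inv a \<otimes> (a \<otimes> b) \<in> H2"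
          using True H2(1) by (simp add: subgroup.m_closed subgroup.m_inv_closed)
        then show False using a b subgroup.mem_carrier[OF dM(2)] by (simp add: mult_inv_cancel)
      qed
      moreover have "a \<otimes> b \<notin> H" using dH(5)[of a b] a b True dM(3) by auto
      ultimately show ?thesis using subgroup.m_closed[OF dM(2) a(1) b(1)] by blast
    qed (use a b in blast)
    then obtain w where w: "w \<in> M" "w \<notin> H" "w \<notin> H2" by blast
    show thesis
    proof (rule that[of ?D "?D \<inter> H" w])
      show "index_two (?D \<inter> H) ?D" by (rule index_two_Int[OF D H(1) DH])
      show "?D \<inter> (H1 \<union> H2) \<subseteq> ?D \<inter> H" using H(2) M(2) by blast
    qed (use D w H(2) dM(3) in auto)
  qed
qed

text \<open>The asymmetric condition on \<open>H2\<close> keeps the induction closed: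
  \<open>H2 \<subseteq> H1\<close> admits instances with a single avoided subgroup, taken as both
  \<open>H1\<close> and \<open>H2\<close>.\<close>

lemma card_derived_le:
  assumes "subgroup S G" "subgroup H1 G" "H1 \<subset> S" "subgroup H2 G" "H2 \<subseteq> S"
    and "H2 \<subseteq> H1 \<or> 4 * card H2 \<le> card S"
    and "\<And>x. x \<in> S \<Longrightarrow> x \<notin> H1 \<Longrightarrow> x \<notin> H2 \<Longrightarrow> class_size S x < 2 ^ n"
  shows "card (derived G S) \<le> 2 ^ triangle n"
  using assms
proof (induction "card S" arbitrary: S H1 H2 n rule: less_induct)
  case less
  show ?case
  proof (cases "card (derived G S) = 1")
    case False
    then obtain D K w where D: "index_two D S" and K: "index_two K D" and DK: "D \<inter> (H1 \<union> H2) \<subseteq> K"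
      and w: "w \<in> S" "w \<notin> D" "w \<notin> H1" "w \<notin> H2"
      using index_two_avoiding[OF less.prems(1-6)] by blast
    note dD = index_twoD[OF D] and dK = index_twoD[OF K]
    interpret S: subgroup S G by (rule dD)
    interpret D: subgroup D G by (rule dD)
    have fS: "finite S" and fD: "finite D" using finite_subgroup dD by auto
    have cD: "0 < card D" using fD D.one_closed card_gt_0_iff by blast
    have cS: "card D < card S" using card_index_two[OF D fS] cD by simp
    obtain m where n: "n = Suc m"
      using less.prems(7)[OF w(1,3,4)] class_size_pos[OF dD(1) fS, of w] by (cases n) auto
    have bS: "class_size S x \<le> 2 ^ m" if "x \<in> S" "x \<notin> H1" "x \<notin> H2" for x
      using class_size_le_if_less[OF dD(1)] less.prems(7)[OF that] that(1) n by simp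
    have bD: "y \<in> S" "class_size S y \<le> 2 ^ m" "class_size D y \<le> 2 ^ m" if "y \<in> D" "y \<notin> K" for y
    proof -
      show "y \<in> S" using that dD(3) by blast
      then show "class_size S y \<le> 2 ^ m" using bS that DK by blast
      then show "class_size D y \<le> 2 ^ m" using class_size_mono[OF fS dD(3), of y] by simp
    qed
    define E where "E = {d \<in> D. comm d w \<in> derived G D}"
    have E: "subgroup E G" unfolding E_def by (rule commuting_mod_derived_subgroup[OF D w(1)])
    have ED: "E \<subseteq> D" by (auto simp: E_def)
    have SD: "card (derived G S) * card E = card D * card (derived G D)"
      unfolding E_def by (rule card_derived_index_two[OF D fS w(1,2)])
    have bE: "class_size D y < 2 ^ m" if y: "y \<in> D" "y \<notin> K" "y \<notin> E" for y
    proof (rule ccontr)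
      assume "\<not> ?thesis"
      then have "class_size S y \<le> class_size D y" using bD[OF y(1,2)] by simp
      then have "(\<lambda>s. comm s y) ` D = (\<lambda>s. comm s y) ` S"
        using dD(3) fS unfolding class_size_def by (intro card_seteq) auto
      then obtain d where d: "d \<in> D" "comm w y = comm d y" using w(1) by blast
      interpret dD: subgroup "derived G D" G using derived_is_subgroup D.subset by blast
      have "comm d y \<in> derived G D" using comm_in_derived d y by blast
      then have "inv (comm w y) \<in> derived G D" using d by simp
      then have "comm y w \<in> derived G D" using inv_comm_eq w y by simp
      then show False using y by (simp add: E_def)
    qed
    show ?thesis
    proof (cases "E = D")
      case True
      \<comment> \<open>By \<open>SD\<close> the derived subgroups of \<open>S\<close> and
        \<open>D\<close> have the same order here, so the bound may keep \<open>n\<close>, and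
        avoiding \<open>K\<close> alone is enough.\<close>
      have "card (derived G D) \<le> 2 ^ triangle n"
      proof (rule less.hyps[OF cS dD(2) dK(2) _ dK(2)])
        show "class_size D x < 2 ^ n" if "x \<in> D" "x \<notin> K" for x
          using bD(3)[OF that] n by (simp add: order_le_less_trans)
      qed (use dK in auto)
      then show ?thesis using SD True cD by simp
    next
      case ne: False
      show ?thesis
      proof (cases "E \<subseteq> K \<or> 4 * card E \<le> card D")
        case True
        have "card (derived G D) \<le> 2 ^ triangle m"
          by (rule less.hyps[OF cS dD(2) dK(2) _ E ED True bE]) (use dK in auto)
        moreover have "card (derived G S) \<le> class_size D w * card (derived G D)"
          by (rule card_derived_le_class_size[OF D fS w(1,2)])
        moreover have "class_size D w \<le> 2 ^ m"
          using bS[OF w(1,3,4)] class_size_mono[OF fS dD(3), of w] by simp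
        ultimately have "card (derived G S) \<le> 2 ^ m * 2 ^ triangle m"
          by (meson le_trans mult_le_mono)
        then show ?thesis by (simp add: n triangle_Suc power_add)
      next
        case False
        \<comment> \<open>The index of \<open>E\<close> in \<open>D\<close> is a power of two
          strictly between one and four.\<close>
        obtain a where a: "card E = 2 ^ a" using card_subgroup E .
        obtain b where b: "card D = 2 ^ b" using card_subgroup dD(2) .
        have "card E < card D" using ne ED fD by (intro psubset_card_mono) auto
        then have "a < b" using a b by simp
        moreover have "b < a + 2"
        proof (rule ccontr)
          assume "\<not> b < a + 2"
          then have "(2::nat) ^ (a + 2) \<le> 2 ^ b" by (intro power_increasing) auto
          then show False using False a b by simp
        qed
        ultimately have "b = Suc a" by simp
        then have cE: "card D = 2 * card E" using a b by simp
        have hE: "index_two E D" by (rule index_two_of_card[OF dD(2) E ED cE])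
        have "card (derived G D) < 2 ^ triangle n" unfolding n
        proof (rule card_derived_less[OF _ K hE])
          fix S' H k
          assume "subgroup S' G" "card S' < card D" "subgroup H G" "H \<subset> S'"
            "\<And>x. x \<in> S' \<Longrightarrow> x \<notin> H \<Longrightarrow> class_size S' x < 2 ^ k"
          then show "card (derived G S') \<le> 2 ^ triangle k"
            using cS by (intro less.hyps[of S' H H k]) auto
        qed (use False bD(3) bE in auto)
        moreover have "card (derived G S) = 2 * card (derived G D)"
          using SD cE a by simp
        \<comment> \<open>A power of two strictly below \<open>2 ^ triangle n\<close> can be doubled
          without exceeding it.\<close>
        moreover obtain c where "card (derived G D) = 2 ^ c"
          using card_subgroup derived_is_subgroup[OF D.subset] .
        ultimately have "c < triangle n" "card (derived G S) = 2 ^ Suc c" by simp_all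
        then show ?thesis by (simp only: power_increasing Suc_leI one_le_numeral)
      qed
    qed
  qed simp
qed

end

section \<open>From class sizes to breadth\<close>

theorem theorem1p3:
  fixes G (structure) and n :: nat
  assumes "group G"
    and "finite (carrier G)"
    and "\<exists>k::nat. card (carrier G) = 2 ^ k"
    and "card (derived G (carrier G)) > 2 ^ (n * (n - 1) div 2)"
  shows "\<not> (\<exists>H1 H2. subgroup H1 G \<and> subgroup H2 G
              \<and> H1 \<noteq> carrier G \<and> H2 \<noteq> carrier G
              \<and> (subgroup_index G H1 \<ge> 4 \<or> subgroup_index G H2 \<ge> 4)
              \<and> (\<forall>x \<in> carrier G. breadth G x \<ge> n \<longrightarrow> x \<in> H1 \<union> H2))"
proof -
  interpret finite_two_group G
    using assms by (simp add: finite_two_group_def finite_two_group_axioms_def)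
  \<comment> \<open>The definite description in \<open>breadth\<close> denotes because the index of
    the centralizer is a power of two.\<close>
  have breadth: "class_size (carrier G) x = 2 ^ breadth G x" if x: "x \<in> carrier G" for x
  proof -
    have cent: "cent (carrier G) x = centralizer G x" by (simp add: cent_def centralizer_def)
    have card: "card (carrier G) = class_size (carrier G) x * card (centralizer G x)"
      using card_eq_class_size_cent[OF subgroup_self fin x] cent by simp
    have "card (centralizer G x) \<noteq> 0"
      using card two by (metis mult_0_right power_not_zero zero_neq_numeral)
    then have index: "subgroup_index G (centralizer G x) = class_size (carrier G) x"
      using card by (simp add: subgroup_index_def)
    have "class_size (carrier G) x dvd 2 ^ k" if "card (carrier G) = 2 ^ k" for k
      using card that by (metis dvd_triv_left)
    then obtain b where "class_size (carrier G) x = 2 ^ b"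
      using two divides_primepow_nat[OF two_is_prime_nat] by metis
    then show ?thesis unfolding breadth_def index by simp
  qed
  \<comment> \<open>By symmetry \<open>H2\<close> is taken to be the subgroup of index at least
    four; \<open>Un_commute\<close> performs the swap at the end.\<close>
  have False
    if H1: "subgroup H1 G" "H1 \<noteq> carrier G" and H2: "subgroup H2 G" "subgroup_index G H2 \<ge> 4"
      and cover: "\<forall>x \<in> carrier G. breadth G x \<ge> n \<longrightarrow> x \<in> H1 \<union> H2" for H1 H2
  proof -
    have "card (derived G (carrier G)) \<le> 2 ^ triangle n"
    proof (rule card_derived_le[OF subgroup_self H1(1) _ H2(1)])
      show "H1 \<subset> carrier G" using H1 subgroup.subset by blast
      show "H2 \<subseteq> carrier G" using H2 subgroup.subset by blast
      have "4 * card H2 \<le> card (carrier G) div card H2 * card H2"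
        using H2(2) by (simp add: subgroup_index_def)
      then have "4 * card H2 \<le> card (carrier G)"
        by (meson div_times_less_eq_dividend le_trans)
      then show "H2 \<subseteq> H1 \<or> 4 * card H2 \<le> card (carrier G)" by simp
      show "class_size (carrier G) x < 2 ^ n" if "x \<in> carrier G" "x \<notin> H1" "x \<notin> H2" for x
        using cover that breadth by (auto simp: not_le[symmetric])
    qed
    then show False using assms(4) by (simp add: triangle_def)
  qed
  then show ?thesis by (metis Un_commute)
qed

end
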